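(* For all integers $s\ge 1$, $r\ge 2$ and $d\ge 2r-2$, one has $f_{r}(d,s,\ldots,s) > s^{r}$ (with $s$ repeated $r$ times).
   Context: An $s$-convex set in $\mathbb{R}^d$ is a union of $s$ convex sets. For integers $d\ge 1$, $r\ge 2$ and $s_1,\dots,s_r\ge 1$, $f_r(d,s_1,\ldots,s_r)$ denotes the least integer $n$ such that every $n$-point set $P\subseteq\mathbb{R}^d$ admits a partition $P=P_1\sqcup\cdots\sqcup P_r$ with the property that for every choice of $s_i$-convex sets $C_i\supseteq P_i$ ($i\in[r]$) one necessarily has $\bigcap_{i=1}^r C_i\neq\emptyset$. *)

theory Defs
  imports "HOL-Analysis.Analysis" "HOL-Library.Extended_Nat" "HOL-Library.Disjoint_Sets"
begin

text \<open>The convex sets in the union may coincide or be empty; in particular the empty set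
  is \<open>s\<close>-convex for every \<open>s\<close>.\<close>

definition s_convex :: "nat \<Rightarrow> 'a::real_vector set \<Rightarrow> bool" where
  "s_convex s C \<longleftrightarrow> (\<exists>K :: nat \<Rightarrow> 'a set. (\<forall>j<s. convex (K j)) \<and> C = (\<Union>j<s. K j))"

text \<open>Parts are not required to be nonempty, but an empty part \<open>Q i\<close> never satisfies the
  condition below, since \<open>C i = {}\<close> is then an admissible choice.\<close>

definition admits_partition :: "nat \<Rightarrow> (nat \<Rightarrow> nat) \<Rightarrow> 'a::real_vector set \<Rightarrow> bool" where
  "admits_partition r s P \<longleftrightarrow>
     (\<exists>Q :: nat \<Rightarrow> 'a set.
        disjoint_family_on Q {1..r} \<and> P = (\<Union>i\<in>{1..r}. Q i) \<and>
        (\<forall>C :: nat \<Rightarrow> 'a set.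
           (\<forall>i\<in>{1..r}. s_convex (s i) (C i) \<and> Q i \<subseteq> C i) \<longrightarrow> (\<Inter>i\<in>{1..r}. C i) \<noteq> {}))"

definition all_admit_partition :: "'d::finite itself \<Rightarrow> nat \<Rightarrow> (nat \<Rightarrow> nat) \<Rightarrow> nat \<Rightarrow> bool" where
  "all_admit_partition D r s n \<longleftrightarrow>
     (\<forall>P :: (real ^ 'd) set. finite P \<and> card P = n \<longrightarrow> admits_partition r s P)"

text \<open>\<open>f_num TYPE('d) r s\<close> is $f_r(d,s_1,\dots,s_r)$ with \<open>d = CARD('d)\<close> and \<open>s i\<close> for $s_i$,
  \<open>i \<in> {1..r}\<close>. The value lies in \<open>enat\<close>, so that it would be \<open>\<infinity>\<close> if there were no such \<open>n\<close>;
  otherwise the infimum is attained, see \<open>f_num_eq_iff\<close>.\<close>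

definition f_num :: "'d::finite itself \<Rightarrow> nat \<Rightarrow> (nat \<Rightarrow> nat) \<Rightarrow> enat" where
  "f_num D r s = Inf {enat n | n. all_admit_partition D r s n}"

lemma f_num_eq_iff:
  "f_num D r s = enat n \<longleftrightarrow>
     all_admit_partition D r s n \<and> (\<forall>m<n. \<not> all_admit_partition D r s m)"
proof -
  let ?A = "{enat n | n. all_admit_partition D r s n}"
  have mem: "enat k \<in> ?A \<longleftrightarrow> all_admit_partition D r s k" for k by auto
  have low: "f_num D r s \<le> enat k" if "all_admit_partition D r s k" for k
    unfolding f_num_def using that by (intro Inf_lower) auto
  show ?thesis
  proof (intro iffI conjI allI impI)
    assume eq: "f_num D r s = enat n"
    have "?A \<noteq> {}"
      using eq unfolding f_num_def by (metis Inf_enat_def enat.distinct(1) infinity_enat_def)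
    then have "Inf ?A \<in> ?A" by (metis (no_types, lifting) Inf_enat_def LeastI ex_in_conv)
    then show "all_admit_partition D r s n" using eq mem unfolding f_num_def by simp
    fix m assume "m < n"
    then show "\<not> all_admit_partition D r s m" using low[of m] eq by auto
  next
    assume *: "all_admit_partition D r s n \<and> (\<forall>m<n. \<not> all_admit_partition D r s m)"
    have "enat n \<le> f_num D r s"
      unfolding f_num_def using * by (intro Inf_greatest) (auto simp: not_less[symmetric])
    with low[of n] * show "f_num D r s = enat n" by auto
  qed
qed

end

theory Submission
  imports Defs
begin

text \<open>The \<open>s ^ r\<close> points \<open>p x\<close> are indexed by digit sequences \<open>x\<close> of length \<open>r\<close> with digits below
  \<open>s\<close>. Whatever the partition, the points of the \<open>i\<close>-th part are grouped by their \<open>i\<close>-th digit. The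
  groups of digits \<open>x 1, \<dots>, x r\<close> can only have the single point \<open>p x\<close> in common, and \<open>p x\<close> lies
  in only one part. To see that their hulls do not meet it suffices to find linear functionals
  \<open>\<phi> 1, \<dots>, \<phi> r\<close> with sum \<open>0\<close> such that \<open>\<phi> i\<close>, on the points with \<open>i\<close>-th digit \<open>x i\<close>, has its
  strict minimum at \<open>p x\<close>.

  Let \<open>a\<^sub>j = B ^ j * x j\<close> with \<open>B\<close> large and \<open>m = \<Sum>\<^sub>j a\<^sub>j\<close>. The point \<open>p x\<close> has the coordinates
  \<open>u\<^sub>i = m - r a\<^sub>i\<close> and \<open>v\<^sub>i = m\<^sup>2/2 - r a\<^sub>i (a\<^sub>i/2 + \<Sum>\<^sub>j\<^sub>>\<^sub>i a\<^sub>j)\<close> for \<open>i < r\<close>. Both families sum to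
  \<open>0\<close> over \<open>i \<le> r\<close>, so that \<open>\<phi> i = v\<^sub>i - m(x) u\<^sub>i\<close> is linear also for \<open>i = r\<close>. On the points with
  a fixed \<open>i\<close>-th digit, \<open>\<phi> i\<close> exceeds its value at \<open>p x\<close> by \<open>(\<Delta>m)\<^sup>2/2\<close> up to an error that is
  negligible for large \<open>B\<close>.\<close>

text \<open>Half-spaces are convex, so a common point \<open>q\<close> of the hulls would satisfy
  \<open>\<phi> i p \<le> \<phi> i q\<close> for all \<open>i\<close>, strictly for
  \<open>k\<close>. Summing over \<open>i\<close> gives 0 < 0.\<close>

lemma Inter_convex_hull_empty:
  fixes \<phi> :: "'i \<Rightarrow> 'a::real_vector \<Rightarrow> real"
  assumes fin: "finite I" and lin: "\<And>i. i \<in> I \<Longrightarrow> linear (\<phi> i)"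
    and sum0: "\<And>q. (\<Sum>i\<in>I. \<phi> i q) = 0"
    and le: "\<And>i z. i \<in> I \<Longrightarrow> z \<in> A i \<Longrightarrow> \<phi> i p \<le> \<phi> i z"
    and k: "k \<in> I" and less: "\<And>z. z \<in> A k \<Longrightarrow> \<phi> k p < \<phi> k z"
  shows "(\<Inter>i\<in>I. convex hull A i) = {}"
proof (rule ccontr)
  assume "(\<Inter>i\<in>I. convex hull A i) \<noteq> {}"
  then obtain q where q: "\<And>i. i \<in> I \<Longrightarrow> q \<in> convex hull A i" by blast
  have "\<phi> i p \<le> \<phi> i q" if i: "i \<in> I" for i
  proof -
    have "convex hull A i \<subseteq> \<phi> i -` {\<phi> i p..}"
      using le[OF i] by (intro hull_minimal convex_linear_vimage[OF lin[OF i]]) auto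
    then show ?thesis using q[OF i] by auto
  qed
  moreover have "\<phi> k p < \<phi> k q"
  proof -
    have "convex hull A k \<subseteq> \<phi> k -` {\<phi> k p<..}"
      using less by (intro hull_minimal convex_linear_vimage[OF lin[OF k]]) auto
    then show ?thesis using q[OF k] by auto
  qed
  ultimately have "(\<Sum>i\<in>I. \<phi> i p) < (\<Sum>i\<in>I. \<phi> i q)"
    using fin k by (intro sum_strict_mono_ex1) auto
  then show False using sum0 by simp
qed

lemma not_admits_partition_image:
  fixes p :: "(nat \<Rightarrow> nat) \<Rightarrow> 'a::real_vector" and r s :: nat
  defines "Y \<equiv> {1..r} \<rightarrow>\<^sub>E {..<s}"
  assumes r: "r \<ge> 2" and X: "X \<subseteq> Y"
    and sep: "\<And>x. x \<in> Y \<Longrightarrow> \<exists>\<phi>. (\<forall>i\<in>{1..r}. linear (\<phi> i)) \<and> (\<forall>q. (\<Sum>i=1..r. \<phi> i q) = 0) \<and>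
      (\<forall>i\<in>{1..r}. \<forall>y\<in>Y. y i = x i \<and> y \<noteq> x \<longrightarrow> \<phi> i (p x) < (\<phi> i (p y) :: real))"
  shows "\<not> admits_partition r (\<lambda>i. s) (p ` X)"
proof
  assume "admits_partition r (\<lambda>i. s) (p ` X)"
  then obtain Q where disj: "disjoint_family_on Q {1..r}"
    and cov: "p ` X = (\<Union>i\<in>{1..r}. Q i)"
    and meet: "\<And>C. \<forall>i\<in>{1..r}. s_convex s (C i) \<and> Q i \<subseteq> C i \<Longrightarrow> (\<Inter>i\<in>{1..r}. C i) \<noteq> {}"
    unfolding admits_partition_def by blast
  define K where "K i j = p ` {y\<in>X. y i = j} \<inter> Q i" for i j
  define C where "C i = (\<Union>j<s. convex hull K i j)" for i
  have "s_convex s (C i)" for i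
    unfolding s_convex_def C_def
    by (rule exI[of _ "\<lambda>j. convex hull K i j"]) (simp add: convex_convex_hull)
  moreover have "Q i \<subseteq> C i" if i: "i \<in> {1..r}" for i
  proof
    fix z assume z: "z \<in> Q i"
    with cov i obtain y where y: "y \<in> X" "z = p y" by blast
    then have "z \<in> K i (y i)" using z by (auto simp: K_def)
    moreover have "y i < s" using y(1) X i by (auto simp: Y_def PiE_def Pi_def)
    ultimately show "z \<in> C i" unfolding C_def using hull_inc by fastforce
  qed
  ultimately have "(\<Inter>i\<in>{1..r}. C i) \<noteq> {}" by (intro meet) auto
  then obtain q where "\<forall>i\<in>{1..r}. \<exists>j<s. q \<in> convex hull K i j"
    unfolding C_def by blast
  \<comment> \<open>The groups whose hulls contain \<open>q\<close> select one digit for each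
    \<open>i\<close>; these digits form the index \<open>x\<close> of the only point that all the
    groups could share.\<close>
  then obtain j where j: "\<And>i. i \<in> {1..r} \<Longrightarrow> j i < s \<and> q \<in> convex hull K i (j i)" by metis
  define x where "x = restrict j {1..r}"
  have xY: "x \<in> Y" using j by (auto simp: x_def Y_def)
  have xi: "x i = j i" if "i \<in> {1..r}" for i using that by (simp add: x_def)
  from sep[OF xY] obtain \<phi> :: "nat \<Rightarrow> 'a \<Rightarrow> real" where
    \<phi>: "(\<forall>i\<in>{1..r}. linear (\<phi> i)) \<and> (\<forall>q. (\<Sum>i=1..r. \<phi> i q) = 0) \<and>
      (\<forall>i\<in>{1..r}. \<forall>y\<in>Y. y i = x i \<and> y \<noteq> x \<longrightarrow> \<phi> i (p x) < \<phi> i (p y))" ..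
  have lin: "\<forall>i\<in>{1..r}. linear (\<phi> i)" by (rule \<phi>[THEN conjunct1])
  have sum0: "(\<Sum>i=1..r. \<phi> i q) = 0" for q using \<phi>[THEN conjunct2, THEN conjunct1] by (rule spec)
  have less: "\<phi> i (p x) < \<phi> i (p y)" if "i \<in> {1..r}" "y \<in> Y" "y i = x i" "y \<noteq> x" for i y
    using \<phi>[THEN conjunct2, THEN conjunct2, THEN bspec, OF that(1)] that by simp
  \<comment> \<open>As \<open>Q 1\<close> and \<open>Q 2\<close> are disjoint, one of them misses
    \<open>p x\<close>. In that part the group cannot contain \<open>p x\<close>, so its inequality
    is strict.\<close>
  obtain k where k: "k \<in> {1..r}" "p x \<notin> Q k"
  proof -
    have "Q 1 \<inter> Q 2 = {}" using disj r by (auto simp: disjoint_family_on_def)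
    then show ?thesis using that[of 1] that[of 2] r by auto
  qed
  have "(\<Inter>i\<in>{1..r}. convex hull K i (j i)) = {}"
  proof (rule Inter_convex_hull_empty[where \<phi> = \<phi> and p = "p x" and k = k])
    fix i z assume i: "i \<in> {1..r}" and "z \<in> K i (j i)"
    then obtain y where "y \<in> Y" "y i = x i" "z = p y" using X xi by (auto simp: K_def)
    then show "\<phi> i (p x) \<le> \<phi> i z" using less[OF i, of y] by (cases "y = x") auto
  next
    fix z assume z: "z \<in> K k (j k)"
    then obtain y where "y \<in> Y" "y k = x k" "z = p y" using X xi k by (auto simp: K_def)
    moreover have "z \<in> Q k" using z by (auto simp: K_def)
    ultimately show "\<phi> k (p x) < \<phi> k z" using less[OF k(1), of y] k(2) by auto
  qed (use lin sum0 k in auto)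
  then show False using j by blast
qed

text \<open>Expanding the square, each product of two distinct terms occurs once on the left. This
  is what makes the \<open>v i\<close> of the construction sum to 0.\<close>

lemma half_square_sum:
  fixes a :: "nat \<Rightarrow> real"
  shows "(\<Sum>i=1..r. a i * (a i / 2 + (\<Sum>j\<in>{i<..r}. a j))) = (\<Sum>i=1..r. a i)\<^sup>2 / 2"
proof (induction r)
  case (Suc r)
  have "(\<Sum>i=1..r. a i * (a i / 2 + (\<Sum>j\<in>{i<..Suc r}. a j))) =
    (\<Sum>i=1..r. a i * (a i / 2 + (\<Sum>j\<in>{i<..r}. a j)) + a i * a (Suc r))"
  proof (rule sum.cong)
    fix i assume "i \<in> {1..r}"
    then have "{i<..Suc r} = insert (Suc r) {i<..r}" by auto
    then show "a i * (a i / 2 + (\<Sum>j\<in>{i<..Suc r}. a j)) =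
      a i * (a i / 2 + (\<Sum>j\<in>{i<..r}. a j)) + a i * a (Suc r)"
      by (simp add: algebra_simps)
  qed simp
  also have "\<dots> = (\<Sum>i=1..r. a i)\<^sup>2 / 2 + (\<Sum>i=1..r. a i) * a (Suc r)"
    using Suc by (simp add: sum.distrib sum_distrib_right)
  finally show ?case by (simp add: power2_eq_square field_simps)
qed simp

text \<open>In the induction step the doubled sum is below
  \<open>B ^ i + 2 * B ^ i * (s - 1)\<close>, which is less than
  \<open>2 * s * B ^ i \<le> B ^ Suc i\<close>.\<close>

lemma abs_digit_sum_less:
  fixes D :: "nat \<Rightarrow> real" and B s :: real
  assumes s: "1 \<le> s" and B: "2 * s \<le> B" and D: "\<And>j. j \<in> {1..<i} \<Longrightarrow> \<bar>D j\<bar> \<le> s - 1"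
  shows "2 * \<bar>\<Sum>j\<in>{1..<i}. B ^ j * D j\<bar> < B ^ i"
  using D
proof (induction i)
  case (Suc i)
  have B0: "0 < B" using s B by linarith
  show ?case
  proof (cases "i = 0")
    case False
    let ?S = "\<Sum>j\<in>{1..<i}. B ^ j * D j"
    have "2 * \<bar>?S\<bar> < B ^ i" using Suc by auto
    moreover have "\<bar>B ^ i * D i\<bar> \<le> B ^ i * (s - 1)"
      using Suc.prems[of i] False B0 by (auto simp: abs_mult)
    then have "\<bar>B ^ i * D i\<bar> \<le> B ^ i * s - B ^ i" by (simp add: right_diff_distrib)
    moreover have "B ^ i * (2 * s) \<le> B ^ i * B" using B B0 by (intro mult_left_mono) auto
    then have "2 * (B ^ i * s) \<le> B ^ Suc i" by (simp add: mult_ac)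
    moreover have "(\<Sum>j\<in>{1..<Suc i}. B ^ j * D j) = ?S + B ^ i * D i"
      using False by simp
    moreover have "B ^ i > 0" using B0 by simp
    ultimately show ?thesis by linarith
  qed (use B0 in simp)
qed simp

text \<open>The difference of the two sides, halved, is the increase of \<open>\<phi> i\<close> from
  \<open>p x\<close> to \<open>p y\<close>. Let \<open>t\<close> be the highest position where
  \<open>x\<close> and \<open>y\<close> differ. For \<open>t < i\<close> the left side vanishes; for
  \<open>t > i\<close> the change of \<open>m\<close> is of order at least \<open>B ^ t\<close> and
  dominates \<open>a x i\<close>.\<close>

lemma digit_separation:
  fixes x y :: "nat \<Rightarrow> nat" and r s i :: nat and B :: real
  defines "a \<equiv> \<lambda>x j. B ^ j * real (x j)"
  defines "m \<equiv> \<lambda>x. \<Sum>j=1..r. a x j"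
  assumes B: "B = 8 * real r * real s" and i: "i \<in> {1..r}" and eq: "y i = x i"
    and ne: "\<exists>j\<in>{1..r}. y j \<noteq> x j"
    and x: "\<And>j. j \<in> {1..r} \<Longrightarrow> x j < s" and y: "\<And>j. j \<in> {1..r} \<Longrightarrow> y j < s"
  shows "2 * real r * a x i * ((\<Sum>j\<in>{i<..r}. a y j) - (\<Sum>j\<in>{i<..r}. a x j)) < (m y - m x)\<^sup>2"
proof -
  define D where "D j = real (y j) - real (x j)" for j
  define \<Delta> where "\<Delta> = m y - m x"
  define H where "H = (\<Sum>j\<in>{i<..r}. a y j) - (\<Sum>j\<in>{i<..r}. a x j)"
  have s1: "real s \<ge> 1" using x[OF i] by simp
  have r1: "real r \<ge> 1" using i by simp
  have "1 * real s \<le> real r * real s" using r1 s1 by (intro mult_right_mono) auto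
  then have B2: "2 * real s \<le> B" and B1: "B \<ge> 1" using s1 B by linarith+
  have absD: "\<bar>D j\<bar> \<le> real s - 1" if "j \<in> {1..r}" for j
    using x[OF that] y[OF that] by (auto simp: D_def)
  have low: "2 * \<bar>\<Sum>j\<in>{1..<t}. B ^ j * D j\<bar> < B ^ t" if "t \<le> r" for t
    using that absD by (intro abs_digit_sum_less[OF s1 B2]) auto
  have \<Delta>: "\<Delta> = (\<Sum>j=1..r. B ^ j * D j)"
    by (simp add: \<Delta>_def m_def a_def D_def sum_subtractf right_diff_distrib)
  have H: "H = (\<Sum>j\<in>{i<..r}. B ^ j * D j)"
    by (simp add: H_def a_def D_def sum_subtractf right_diff_distrib)
  define t where "t = Max {j\<in>{1..r}. y j \<noteq> x j}"
  have "t \<in> {j\<in>{1..r}. y j \<noteq> x j}" unfolding t_def using ne by (intro Max_in) auto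
  then have t: "t \<in> {1..r}" "y t \<noteq> x t" by auto
  have above: "D j = 0" if "t < j" "j \<le> r" for j
  proof (rule ccontr)
    assume "D j \<noteq> 0"
    then have "j \<in> {j\<in>{1..r}. y j \<noteq> x j}" using that by (auto simp: D_def)
    then have "j \<le> t" unfolding t_def by (intro Max_ge) auto
    then show False using that by simp
  qed
  have "\<Delta> = (\<Sum>j\<in>{1..<Suc t}. B ^ j * D j)"
    unfolding \<Delta> using above t by (intro sum.mono_neutral_right) auto
  then have "\<Delta> = (\<Sum>j\<in>{1..<t}. B ^ j * D j) + B ^ t * D t" using t by simp
  moreover have "B ^ t * 1 \<le> B ^ t * \<bar>D t\<bar>"
    using t B1 by (intro mult_left_mono) (auto simp: D_def)
  then have "B ^ t \<le> \<bar>B ^ t * D t\<bar>" using B1 by (simp add: abs_mult)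
  \<comment> \<open>The leading term has size at least \<open>B ^ t\<close>, and the lower ones
    cancel less than half of it.\<close>
  ultimately have big: "2 * \<bar>\<Delta>\<bar> > B ^ t" using low[of t] t(1) unfolding atLeastAtMost_iff by linarith
  moreover have "B ^ t > 0" using B1 by simp
  ultimately have pos: "\<bar>\<Delta>\<bar> > 0" by linarith
  show ?thesis
  proof (cases "t < i")
    case True
    then have "H = 0" unfolding H using above by (intro sum.neutral) auto
    then show ?thesis using pos unfolding H_def \<Delta>_def by simp
  next
    case False
    then have ti: "i < t" using t eq by (metis nat_neq_iff)
    have "{1..r} = {1..<i} \<union> ({i} \<union> {i<..r})" using i by auto
    then have "\<Delta> = (\<Sum>j\<in>{1..<i} \<union> ({i} \<union> {i<..r}). B ^ j * D j)" by (simp add: \<Delta>)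
    also have "\<dots> = (\<Sum>j\<in>{1..<i}. B ^ j * D j) + H"
      by (subst sum.union_disjoint, simp, simp, force)
         (simp add: H D_def eq)
    finally have "\<bar>H\<bar> \<le> \<bar>\<Delta>\<bar> + \<bar>\<Sum>j\<in>{1..<i}. B ^ j * D j\<bar>" by linarith
    moreover have "B ^ i \<le> B ^ t" using B1 ti by (intro power_increasing) auto
    ultimately have H2: "\<bar>H\<bar> \<le> 2 * \<bar>\<Delta>\<bar>" using low[of i] i big unfolding atLeastAtMost_iff by linarith
    have "B ^ i * B \<le> B ^ t" using power_increasing[of "Suc i" t B] B1 ti by (simp add: mult.commute)
    \<comment> \<open>The factor 8 in \<open>B\<close> is chosen for this: 2 from
      \<open>big\<close>, 2 from \<open>H2\<close> and 2 from the left side of the claim.\<close>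
    then have L: "8 * real r * (B ^ i * real s) < 2 * \<bar>\<Delta>\<bar>" using big B by (simp add: ac_simps)
    have ai: "0 \<le> a x i" "a x i \<le> B ^ i * real s"
      using B1 x[OF i] by (auto simp: a_def intro!: mult_left_mono)
    have "2 * real r * a x i * H \<le> 2 * real r * a x i * (2 * \<bar>\<Delta>\<bar>)"
      using H2 ai by (intro mult_left_mono) auto
    also have "\<dots> \<le> 2 * real r * (B ^ i * real s) * (2 * \<bar>\<Delta>\<bar>)"
      using ai by (intro mult_right_mono mult_left_mono) auto
    also have "\<dots> < \<bar>\<Delta>\<bar> * \<bar>\<Delta>\<bar>"
    proof -
      have "4 * real r * (B ^ i * real s) < \<bar>\<Delta>\<bar>" using L by linarith
      then have "4 * real r * (B ^ i * real s) * \<bar>\<Delta>\<bar> < \<bar>\<Delta>\<bar> * \<bar>\<Delta>\<bar>"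
        using pos by (intro mult_strict_right_mono)
      then show ?thesis by (simp add: algebra_simps)
    qed
    finally show ?thesis unfolding H_def \<Delta>_def by (simp add: power2_eq_square)
  qed
qed

lemma ex_separated_points:
  fixes r s :: nat
  defines "Y \<equiv> {1..r} \<rightarrow>\<^sub>E {..<s}"
  assumes r: "r \<ge> 2" and d: "CARD('d::finite) \<ge> 2 * r - 2"
  obtains p :: "(nat \<Rightarrow> nat) \<Rightarrow> real ^ 'd" where "inj_on p Y"
    and "\<And>x. x \<in> Y \<Longrightarrow> \<exists>\<phi>. (\<forall>i\<in>{1..r}. linear (\<phi> i)) \<and> (\<forall>q. (\<Sum>i=1..r. \<phi> i q) = 0) \<and>
      (\<forall>i\<in>{1..r}. \<forall>y\<in>Y. y i = x i \<and> y \<noteq> x \<longrightarrow> \<phi> i (p x) < (\<phi> i (p y) :: real))"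
proof -
  define B where "B = 8 * real r * real s"
  define a where "a x j = B ^ j * real (x j)" for x :: "nat \<Rightarrow> nat" and j
  define m where "m x = (\<Sum>j=1..r. a x j)" for x
  define u where "u i x = m x - real r * a x i" for i x
  define v where
    "v i x = (m x)\<^sup>2 / 2 - real r * (a x i * (a x i / 2 + (\<Sum>j\<in>{i<..r}. a x j)))" for i x
  have sum_u: "(\<Sum>i=1..r. u i x) = 0" for x
    by (simp add: u_def m_def sum_subtractf flip: sum_distrib_left)
  have sum_v: "(\<Sum>i=1..r. v i x) = 0" for x
    unfolding v_def sum_subtractf sum_distrib_left[symmetric] half_square_sum
    by (simp add: m_def)
  have sep: "v i x - m x * u i x < v i y - m x * u i y"
    if "x \<in> Y" "y \<in> Y" "i \<in> {1..r}" "y i = x i" "y \<noteq> x" for i x y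
  proof -
    have ai: "a y i = a x i" using that by (simp add: a_def)
    have "\<exists>j\<in>{1..r}. y j \<noteq> x j"
      using that by (metis PiE_ext Y_def)
    then have "2 * real r * a x i * ((\<Sum>j\<in>{i<..r}. a y j) - (\<Sum>j\<in>{i<..r}. a x j)) < (m y - m x)\<^sup>2"
      unfolding a_def m_def using that
      by (intro digit_separation[OF B_def]) (auto simp: Y_def PiE_def Pi_def)
    then show ?thesis
      unfolding v_def u_def ai by (simp add: power2_eq_square algebra_simps)
  qed
  have "card ({1..<r} \<times> (UNIV :: bool set)) \<le> card (UNIV :: 'd set)"
    using d by (simp add: card_cartesian_product)
  then obtain \<beta> :: "nat \<times> bool \<Rightarrow> 'd" where \<beta>: "inj_on \<beta> ({1..<r} \<times> UNIV)"
    using card_le_inj[of "{1..<r} \<times> (UNIV :: bool set)" "UNIV :: 'd set"] by auto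
  \<comment> \<open>Coordinates outside the image of \<open>{1..<r} \<times> UNIV\<close> under
    \<open>\<beta>\<close> get unspecified values; the argument reads only the others.\<close>
  define p :: "(nat \<Rightarrow> nat) \<Rightarrow> real ^ 'd" where
    "p x = (\<chi> c. case inv_into ({1..<r} \<times> UNIV) \<beta> c of (i, b) \<Rightarrow> if b then v i x else u i x)" for x
  have p_v: "p x $ \<beta> (i, True) = v i x" and p_u: "p x $ \<beta> (i, False) = u i x"
    if "i \<in> {1..<r}" for i x
    using that by (simp_all add: p_def inv_into_f_f[OF \<beta>] del: One_nat_def)
  have split: "(\<Sum>i=1..r. f i) = (\<Sum>i\<in>{1..<r}. f i) + f r" for f :: "nat \<Rightarrow> real"
  proof -
    have "{1..r} = insert r {1..<r}" using r by auto
    then show ?thesis by simp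
  qed
  have u_eq: "u i x = u i y" and v_eq: "v i x = v i y" if "p x = p y" "i \<in> {1..r}" for i x y
  proof -
    have uv: "u j x = u j y" "v j x = v j y" if "j \<in> {1..<r}" for j
      using p_u[OF that] p_v[OF that] \<open>p x = p y\<close> by metis+
    show "u i x = u i y"
    proof (cases "i = r")
      case True
      then show ?thesis using uv(1) split[of "\<lambda>i. u i x"] split[of "\<lambda>i. u i y"] sum_u by simp
    qed (use uv that in simp)
    show "v i x = v i y"
    proof (cases "i = r")
      case True
      then show ?thesis using uv(2) split[of "\<lambda>i. v i x"] split[of "\<lambda>i. v i y"] sum_v by simp
    qed (use uv that in simp)
  qed
  have "inj_on p Y"
  proof (rule inj_onI, rule ccontr)
    fix x y assume xy: "x \<in> Y" "y \<in> Y" "p x = p y" "x \<noteq> y"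
    have bd: "x j < s" "y j < s" if "j \<in> {1..r}" for j
      using xy that by (auto simp: Y_def PiE_def Pi_def)
    have "s > 0" using bd(1)[of 1] r by simp
    then have B0: "B > 0" using r by (simp add: B_def)
    \<comment> \<open>Subtracting \<open>u 1\<close> from \<open>u 2\<close> eliminates
      \<open>m\<close>. The first digits differ by less than \<open>s\<close>, hence by less than
      \<open>B\<close>, so the second digits agree, and \<open>sep\<close> applies at position
      2.\<close>
    have "real r * (a x 1 - a x 2) = real r * (a y 1 - a y 2)"
      using u_eq[OF xy(3), of 1] u_eq[OF xy(3), of 2] r unfolding u_def
      by (simp add: algebra_simps)
    then have "a x 1 - a x 2 = a y 1 - a y 2" using r by simp
    then have "B * (real (x 1) - real (y 1)) = B * (B * (real (x 2) - real (y 2)))"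
      by (simp add: a_def power2_eq_square algebra_simps)
    then have eq: "real (x 1) - real (y 1) = B * (real (x 2) - real (y 2))" using B0 by simp
    have "y 2 = x 2"
    proof (rule ccontr)
      assume "y 2 \<noteq> x 2"
      then have "B * 1 \<le> B * \<bar>real (x 2) - real (y 2)\<bar>" using B0 by (intro mult_left_mono) auto
      also have "\<dots> = \<bar>real (x 1) - real (y 1)\<bar>" using eq B0 by (simp add: abs_mult)
      also have "\<dots> < real s" using bd[of 1] r by auto
      also have "1 * real s \<le> 8 * real r * real s" using r by (intro mult_right_mono) auto
      finally show False by (simp add: B_def)
    qed
    then show False
      using sep[of x y 2] xy r u_eq[OF xy(3), of 2] v_eq[OF xy(3), of 2] by auto
  qed
  moreover have "\<exists>\<phi>. (\<forall>i\<in>{1..r}. linear (\<phi> i)) \<and> (\<forall>q. (\<Sum>i=1..r. \<phi> i q) = 0) \<and>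
      (\<forall>i\<in>{1..r}. \<forall>y\<in>Y. y i = x i \<and> y \<noteq> x \<longrightarrow> \<phi> i (p x) < (\<phi> i (p y) :: real))"
    if x: "x \<in> Y" for x
  proof -
    define \<psi> where "\<psi> i q = q $ \<beta> (i, True) - m x * q $ \<beta> (i, False)" for i and q :: "real ^ 'd"
    \<comment> \<open>\<open>u r\<close> and \<open>v r\<close> are not coordinates of the points,
      so the last functional is minus the sum of the others; \<open>val\<close> shows that it obeys
      the same formula at each \<open>p y\<close>.\<close>
    define \<phi> where "\<phi> i q = (if i < r then \<psi> i q else - (\<Sum>j\<in>{1..<r}. \<psi> j q))" for i q
    have lin_\<psi>: "linear (\<psi> i)" for i
      unfolding \<psi>_def by (rule linearI) (auto simp: algebra_simps)
    have lin: "linear (\<phi> i)" for i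
      unfolding \<phi>_def
      by (cases "i < r") (auto intro!: lin_\<psi> linear_compose_neg linear_compose_sum)
    have sum0: "(\<Sum>i=1..r. \<phi> i q) = 0" for q
      unfolding split by (simp add: \<phi>_def)
    have val_\<psi>: "\<psi> i (p y) = v i y - m x * u i y" if "i \<in> {1..<r}" for i y
      by (simp only: \<psi>_def p_u[OF that] p_v[OF that])
    have val: "\<phi> i (p y) = v i y - m x * u i y" if i: "i \<in> {1..r}" for i y
    proof (cases "i < r")
      case True
      then show ?thesis using i by (simp add: \<phi>_def val_\<psi>)
    next
      case False
      have "(\<Sum>i=1..r. v i y - m x * u i y) = 0"
        using sum_u[of y] sum_v[of y] by (simp add: sum_subtractf flip: sum_distrib_left)
      then show ?thesis using False i unfolding split by (simp add: \<phi>_def val_\<psi>)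
    qed
    show ?thesis
      using lin sum0 sep[OF x] by (intro exI[of _ \<phi>]) (auto simp: val)
  qed
  ultimately show thesis by (rule that)
qed

theorem theorem1p4:
  fixes s r :: nat
  assumes "s \<ge> 1" and "r \<ge> 2" and "CARD('d::finite) \<ge> 2 * r - 2"
  shows "f_num TYPE('d) r (\<lambda>i. s) > enat (s ^ r)"
proof (rule ccontr)
  let ?Y = "{1..r} \<rightarrow>\<^sub>E {..<s}"
  assume "\<not> ?thesis"
  then obtain n where n: "f_num TYPE('d) r (\<lambda>i. s) = enat n" "n \<le> s ^ r"
    by (cases "f_num TYPE('d) r (\<lambda>i. s)") auto
  then have adm: "all_admit_partition TYPE('d) r (\<lambda>i. s) n" by (simp add: f_num_eq_iff)
  have "card ?Y = s ^ r" by (simp add: card_PiE)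
  \<comment> \<open>The least \<open>n\<close> might lie below \<open>s ^ r\<close>, so a subset
    with exactly \<open>n\<close> indices has to be refuted; no monotonicity in \<open>n\<close> is
    used.\<close>
  then obtain X where X: "X \<subseteq> ?Y" "card X = n" "finite X"
    using n(2) by (metis obtain_subset_with_card_n)
  obtain p :: "(nat \<Rightarrow> nat) \<Rightarrow> real ^ 'd" where inj: "inj_on p ?Y"
    and sep: "\<And>x. x \<in> ?Y \<Longrightarrow> \<exists>\<phi>. (\<forall>i\<in>{1..r}. linear (\<phi> i)) \<and> (\<forall>q. (\<Sum>i=1..r. \<phi> i q) = 0) \<and>
      (\<forall>i\<in>{1..r}. \<forall>y\<in>?Y. y i = x i \<and> y \<noteq> x \<longrightarrow> \<phi> i (p x) < (\<phi> i (p y) :: real))"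
    using ex_separated_points[OF assms(2,3), of s] by blast
  have "\<not> admits_partition r (\<lambda>i. s) (p ` X)"
    by (rule not_admits_partition_image[OF assms(2) X(1) sep])
  moreover have "card (p ` X) = n" using X inj by (metis card_image inj_on_subset)
  ultimately show False using adm X(3) unfolding all_admit_partition_def by blast
qed

end
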